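(* Let $\varphi:[0,\infty)\to[0,\infty)$ be continuous and let $\widetilde\varphi(t)=\max_{0\le s\le t}\varphi(s)$ for $t\in[0,\infty)$. Then the following statements are equivalent. (a) There exists $t>0$ such that $\varphi^n(t)\to\infty$ as $n\to\infty$. (b) There exists $t'>0$ such that the set $\{\varphi^n(t'):n\in\mathbb{N}_0\}$ is unbounded. (c) There exists $T>0$ such that $\widetilde\varphi(t)>t$, for $t\ge T$. (d) There exist $t\ge T>0$ such that $\varphi^n(t)$ and $\widetilde\varphi^{\,n}(T)$ increase strictly with $n$ to $\infty$, and $$\varphi^n(t)\in[\,\widetilde\varphi^{\,n}(T),\widetilde\varphi^{\,n+1}(T)\,],\quad\text{for } n\in\mathbb{N}_0.$$ (e) There exists a sequence $(t_n)_{n\in\mathbb{N}_0}$ of positive real numbers such that $t_n\to\infty$ as $n\to\infty$ and $\varphi(t_n)\ge t_{n+1}$, for $n\in\mathbb{N}_0$.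
   Context: $\varphi^n$ and $\widetilde\varphi^{\,n}$ denote $n$th iterates (with $\varphi^0$ and $\widetilde\varphi^{\,0}$ the identity), and $\mathbb{N}_0=\{0,1,2,\dots\}$. *)

theory Defs
  imports "HOL-Analysis.Analysis"
begin

text \<open>The set here is infinite, so \<^const>\<open>Max\<close> does not apply; \<^const>\<open>Greatest\<close> is the maximum
  whenever one exists (see \<open>running_max\<close> below). For \<open>t < 0\<close> the value is unspecified.\<close>

definition max_fun :: "(real \<Rightarrow> real) \<Rightarrow> real \<Rightarrow> real" where
  "max_fun \<phi> t = (GREATEST y. y \<in> \<phi> ` {0..t})"

lemma running_max:
  fixes \<phi> :: "real \<Rightarrow> real"
  assumes "continuous_on {0..} \<phi>" and "0 \<le> t"
  shows "max_fun \<phi> t \<in> \<phi> ` {0..t}" and "\<And>s. s \<in> {0..t} \<Longrightarrow> \<phi> s \<le> max_fun \<phi> t"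
proof -
  have "continuous_on {0..t} \<phi>"
    using assms(1) by (rule continuous_on_subset) auto
  then obtain x where x: "x \<in> {0..t}" "\<And>s. s \<in> {0..t} \<Longrightarrow> \<phi> s \<le> \<phi> x"
    using continuous_attains_sup[of "{0..t}" \<phi>] assms(2) by auto
  have "max_fun \<phi> t = \<phi> x"
    unfolding max_fun_def by (rule Greatest_equality) (use x in auto)
  with x show "max_fun \<phi> t \<in> \<phi> ` {0..t}" and "\<And>s. s \<in> {0..t} \<Longrightarrow> \<phi> s \<le> max_fun \<phi> t"
    by auto
qed

end

theory Submission
  imports Defs
begin

text \<open>If \<open>max_fun \<phi> t \<le> t\<close> for arbitrarily large \<open>t\<close>, then the interval \<open>{0..t}\<close> is invariant for
  such \<open>t\<close>, so neither orbits nor sequences with \<open>x (Suc n) \<le> \<phi> (x n)\<close> can escape. Otherwise let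
  \<open>a n\<close> be the iterates of \<open>max_fun \<phi>\<close> at a large \<open>T\<close>. They increase to infinity, and by the
  intermediate value theorem \<open>\<phi>\<close> maps \<open>{a n..a (Suc n)}\<close> over the next such interval; compactness
  gives a point whose orbit visits these intervals in order.\<close>

lemma continuous_on_funpow:
  assumes "continuous_on S f" and "f ` S \<subseteq> S"
  shows "continuous_on S (f ^^ n) \<and> (f ^^ n) ` S \<subseteq> S"
proof (induction n)
  case 0
  show ?case by (simp add: id_def)
next
  case (Suc n)
  then show ?case
    using assms continuous_on_compose[of S "f ^^ n" f] continuous_on_subset[of S f]
    by fastforce
qed

text \<open>The covering condition lets any point of \<open>I n\<close> be pulled back step by step
  to \<open>I 0\<close>, so every finite itinerary is realised; the sets of points realising them
  are compact and nested, so they share a point.\<close>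

lemma itinerary_exists:
  fixes f :: "'a::heine_borel \<Rightarrow> 'a"
  assumes cont: "continuous_on S f" and inv: "f ` S \<subseteq> S"
    and comp: "\<And>n. compact (I n)" and sub: "\<And>n. I n \<subseteq> S" and ne: "\<And>n. I n \<noteq> {}"
    and cover: "\<And>n. I (Suc n) \<subseteq> f ` I n"
  obtains t where "\<And>n. (f ^^ n) t \<in> I n"
proof -
  \<comment> \<open>\<open>K n\<close> collects the points that follow the itinerary up to time
    \<open>n\<close>. Intersecting with \<open>I 0\<close> keeps them inside \<open>S\<close>, where
    the iterates are continuous, which makes these preimages closed.\<close>
  define K where "K n = (\<Inter>k\<in>{..n}. I 0 \<inter> (f ^^ k) -` I k)" for n :: nat
  \<comment> \<open>The endpoint \<open>y\<close> is prescribed so that the induction can extend the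
    itinerary at its end: the hypothesis is applied to a preimage of \<open>y\<close> in
    \<open>I n\<close>.\<close>
  have reach: "\<exists>t. (f ^^ n) t = y \<and> (\<forall>k\<le>n. (f ^^ k) t \<in> I k)" if "y \<in> I n" for n y
    using that
  proof (induction n arbitrary: y)
    case 0
    then show ?case by auto
  next
    case (Suc n)
    then obtain z where z: "z \<in> I n" "f z = y" using cover by blast
    with Suc.IH obtain t where "(f ^^ n) t = z" "\<forall>k\<le>n. (f ^^ k) t \<in> I k" by blast
    then show ?case using z Suc.prems by (intro exI[of _ t]) (auto simp: le_Suc_eq)
  qed
  have "K n \<noteq> {}" for n
  proof -
    obtain y where "y \<in> I n" using ne by blast
    then obtain t where "\<forall>k\<le>n. (f ^^ k) t \<in> I k" using reach by blast
    then have "t \<in> K n" unfolding K_def by (auto dest: spec[of _ 0])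
    then show ?thesis by blast
  qed
  moreover have "compact (K n)" for n
  proof -
    have "closed (I 0 \<inter> (f ^^ k) -` I k)" for k
      using continuous_on_funpow[OF cont inv, of k] sub[of 0] comp compact_imp_closed
      by (intro continuous_closed_preimage) (auto intro: continuous_on_subset)
    then have "closed (K n)" unfolding K_def by (intro closed_INT) auto
    moreover have "K n = I 0 \<inter> K n" unfolding K_def by auto
    ultimately show ?thesis using compact_Int_closed[OF comp] by metis
  qed
  moreover have "K n \<subseteq> K m" if "m \<le> n" for m n
    using that unfolding K_def by (intro INT_anti_mono) auto
  ultimately have "\<Inter>(range K) \<noteq> {}" by (intro compact_nest) auto
  then obtain t where "\<And>n. t \<in> K n" by blast
  then have "(f ^^ n) t \<in> I n" for n unfolding K_def by blast
  then show thesis using that by blast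
qed

text \<open>Equality at a single step would be a fixed point, making the orbit constant from there
  on and contradicting divergence.\<close>

lemma strict_mono_orbit:
  fixes f :: "real \<Rightarrow> real"
  assumes le: "\<And>n. (f ^^ n) t \<le> (f ^^ Suc n) t"
    and lim: "filterlim (\<lambda>n. (f ^^ n) t) at_top sequentially"
  shows "strict_mono (\<lambda>n. (f ^^ n) t)"
proof (rule strict_monoI_Suc)
  fix n
  have "(f ^^ Suc n) t \<noteq> (f ^^ n) t"
  proof
    assume fixed: "(f ^^ Suc n) t = (f ^^ n) t"
    have "(f ^^ (k + n)) t = (f ^^ n) t" for k
      by (induction k) (use fixed in auto)
    moreover obtain N where "\<And>m. m \<ge> N \<Longrightarrow> (f ^^ n) t + 1 \<le> (f ^^ m) t"
      using lim by (auto simp: filterlim_at_top eventually_sequentially)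
    then have "(f ^^ n) t + 1 \<le> (f ^^ (N + n)) t" by simp
    ultimately show False by simp
  qed
  with le[of n] show "(f ^^ n) t < (f ^^ Suc n) t" by linarith
qed

lemma filterlim_at_top_not_bdd_above:
  fixes x :: "nat \<Rightarrow> real"
  assumes "filterlim x at_top sequentially"
  shows "\<not> bdd_above (range x)"
proof
  assume "bdd_above (range x)"
  then obtain B where "\<And>n. x n \<le> B" by (auto simp: bdd_above_def)
  moreover obtain n where "B + 1 \<le> x n"
    using assms by (auto simp: filterlim_at_top eventually_sequentially)
  ultimately show False by (metis add_le_same_cancel1 not_one_le_zero order_trans)
qed

text \<open>Asking only for an inequality in \<open>step\<close> lets one argument serve both
  unbounded orbits and the sequences \<open>\<tau>\<close> of the last statement.\<close>

lemma max_fun_gt_of_unbounded: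
  fixes \<phi> :: "real \<Rightarrow> real"
  assumes cont: "continuous_on {0..} \<phi>"
    and nonneg: "\<And>n. 0 \<le> x n" and step: "\<And>n. x (Suc n) \<le> \<phi> (x n)"
    and unb: "\<not> bdd_above (range x)"
  shows "\<exists>T>0. \<forall>t\<ge>T. max_fun \<phi> t > t"
proof (rule ccontr)
  assume "\<not> ?thesis"
  \<comment> \<open>The negation is used at \<open>T = x 0 + 1\<close>, which is positive and places
    \<open>x 0\<close> in the invariant interval \<open>{0..t}\<close>.\<close>
  then obtain t where t: "t \<ge> x 0 + 1" "max_fun \<phi> t \<le> t"
    using nonneg[of 0] by (metis add_nonneg_pos not_le zero_less_one)
  have "x n \<le> t" for n
  proof (induction n)
    case 0
    then show ?case using t by linarith
  next
    case (Suc n)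
    then have "\<phi> (x n) \<le> max_fun \<phi> t"
      using nonneg[of n] by (intro running_max[OF cont]) auto
    then show ?case using step[of n] t by linarith
  qed
  then show False using unb by (auto simp: bdd_above_def)
qed

text \<open>If the iterates were bounded, they would converge to some \<open>L \<ge> T\<close>, and
  \<open>\<phi>\<close> would be at most \<open>L\<close> on all of \<open>{0..L}\<close>, against
  \<open>above\<close> at \<open>L\<close>. The contradiction is sought in \<open>\<phi>\<close>,
  whose continuity is given, rather than in \<open>max_fun \<phi>\<close>.\<close>

lemma funpow_max_fun_tendsto:
  fixes \<phi> :: "real \<Rightarrow> real"
  assumes cont: "continuous_on {0..} \<phi>" and "0 < T" and above: "\<And>t. t \<ge> T \<Longrightarrow> max_fun \<phi> t > t"
  shows "strict_mono (\<lambda>n. (max_fun \<phi> ^^ n) T)"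
    and "filterlim (\<lambda>n. (max_fun \<phi> ^^ n) T) at_top sequentially"
proof -
  define a where "a = (\<lambda>n. (max_fun \<phi> ^^ n) T)"
  have a_Suc: "a (Suc n) = max_fun \<phi> (a n)" for n by (simp add: a_def)
  have ge: "a n \<ge> T" for n
    by (induction n) (use above a_Suc in \<open>force simp: a_def\<close>)+
  have mono: "strict_mono a"
    using above[OF ge] by (intro strict_monoI_Suc) (simp add: a_Suc)
  then show "strict_mono (\<lambda>n. (max_fun \<phi> ^^ n) T)" by (simp add: a_def)
  have "\<not> bdd_above (range a)"
  proof
    assume bdd: "bdd_above (range a)"
    define L where "L = (SUP n. a n)"
    have le_L: "a n \<le> L" for n unfolding L_def using bdd by (intro cSUP_upper) auto
    have lim: "a \<longlonglongrightarrow> L"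
      unfolding L_def using bdd mono by (intro LIMSEQ_incseq_SUP strict_mono_mono) auto
    have "L \<ge> T" using le_L ge order_trans by blast
    then have "L \<ge> 0" using \<open>0 < T\<close> by linarith
    obtain s where s: "s \<in> {0..L}" "\<phi> s > L"
      using running_max(1)[OF cont \<open>L \<ge> 0\<close>] above[OF \<open>L \<ge> T\<close>] by auto
    have le: "\<phi> r \<le> L" if "0 \<le> r" "r \<le> a n" for r n
    proof -
      have "\<phi> r \<le> a (Suc n)"
        unfolding a_Suc using that by (intro running_max[OF cont]) auto
      then show ?thesis using le_L order_trans by blast
    qed
    \<comment> \<open>Every point of \<open>{0..L}\<close> except possibly \<open>L\<close> lies
      below some \<open>a n\<close>, where \<open>le\<close> applies; at \<open>L\<close> itself the
      bound passes to the limit.\<close>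
    have "\<phi> s \<le> L"
    proof (cases "s = L")
      case True
      have "(\<lambda>n. \<phi> (a n)) \<longlonglongrightarrow> \<phi> L"
        using continuous_on_tendsto_compose[OF cont lim] \<open>L \<ge> 0\<close> ge \<open>0 < T\<close>
        by (auto intro!: always_eventually less_imp_le intro: less_le_trans)
      moreover have "\<phi> (a n) \<le> L" for n
        using le[of "a n" n] ge[of n] \<open>0 < T\<close> by simp
      ultimately show ?thesis using True LIMSEQ_le_const2 by blast
    next
      case False
      then obtain n where "s < a n"
        using s order_tendstoD(1)[OF lim, of s] by (auto simp: eventually_sequentially)
      then show ?thesis using le[of s n] s by simp
    qed
    with s show False by simp
  qed
  then have "\<exists>n. a n > B" for B by (auto simp: bdd_above_def not_le)
  then have "filterlim a at_top sequentially"
    unfolding filterlim_at_top eventually_sequentially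
    by (metis less_imp_le mono order_trans strict_mono_less_eq)
  then show "filterlim (\<lambda>n. (max_fun \<phi> ^^ n) T) at_top sequentially" by (simp add: a_def)
qed

lemma escaping_orbit:
  fixes \<phi> :: "real \<Rightarrow> real"
  assumes cont: "continuous_on {0..} \<phi>" and inv: "\<phi> \<in> {0..} \<rightarrow> {0..}"
    and "0 < T" and above: "\<And>t. t \<ge> T \<Longrightarrow> max_fun \<phi> t > t"
  obtains t where "\<And>n. (\<phi> ^^ n) t \<in> {(max_fun \<phi> ^^ n) T .. (max_fun \<phi> ^^ Suc n) T}"
    and "strict_mono (\<lambda>n. (\<phi> ^^ n) t)"
    and "filterlim (\<lambda>n. (\<phi> ^^ n) t) at_top sequentially"
proof -
  define a where "a = (\<lambda>n. (max_fun \<phi> ^^ n) T)"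
  have a_Suc: "a (Suc n) = max_fun \<phi> (a n)" for n by (simp add: a_def)
  have mono: "strict_mono a" and lim: "filterlim a at_top sequentially"
    unfolding a_def using funpow_max_fun_tendsto[OF cont \<open>0 < T\<close> above] by auto
  have pos: "a n > 0" for n
    using \<open>0 < T\<close> strict_mono_mono[OF mono, THEN monoD, of 0 n] by (simp add: a_def)
  have less: "a n < a (Suc n)" for n using mono by (simp add: strict_mono_Suc_iff)
  have cover: "{a (Suc n)..a (Suc (Suc n))} \<subseteq> \<phi> ` {a n..a (Suc n)}" for n
  proof
    fix y assume y: "y \<in> {a (Suc n)..a (Suc (Suc n))}"
    \<comment> \<open>The upper value for the intermediate value theorem is the maximum over
      \<open>{0..a (Suc n)}\<close>, attained at \<open>s\<close>. On \<open>{0..a n}\<close> the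
      values stay below \<open>a (Suc n)\<close>, which both forces \<open>s\<close> to the right of
      \<open>a n\<close> and gives the lower value at \<open>a n\<close>.\<close>
    obtain s where s: "s \<in> {0..a (Suc n)}" "\<phi> s = a (Suc (Suc n))"
      using running_max(1)[OF cont, of "a (Suc n)"] pos[of "Suc n"] by (auto simp: a_Suc)
    have bound: "\<phi> r \<le> a (Suc n)" if "r \<in> {0..a n}" for r
      unfolding a_Suc using that pos[of n] by (intro running_max[OF cont]) auto
    have "a n \<le> s"
      using bound[of s] s less[of "Suc n"] by force
    moreover have "\<phi> (a n) \<le> y" using bound[of "a n"] pos[of n] y by auto
    moreover have "continuous_on {a n..s} \<phi>"
      using cont pos[of n] by (auto intro: continuous_on_subset)
    ultimately obtain r where "a n \<le> r" "r \<le> s" "\<phi> r = y"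
      using IVT'[of \<phi> "a n" y s] y s by auto
    then show "y \<in> \<phi> ` {a n..a (Suc n)}" using s by auto
  qed
  obtain t where t: "\<And>n. (\<phi> ^^ n) t \<in> {a n..a (Suc n)}"
  proof (rule itinerary_exists[OF cont, of "\<lambda>n. {a n..a (Suc n)}"])
    show "\<phi> ` {0..} \<subseteq> {0..}" using inv by auto
    show "{a n..a (Suc n)} \<subseteq> {0..}" for n using pos[of n] by auto
    show "{a n..a (Suc n)} \<noteq> {}" for n using less[of n] by simp
  qed (use cover in auto)
  have t_lim: "filterlim (\<lambda>n. (\<phi> ^^ n) t) at_top sequentially"
    using t by (intro filterlim_at_top_mono[OF lim]) auto
  \<comment> \<open>Consecutive intervals share an endpoint, so the itinerary alone yields only weak
    monotonicity.\<close>
  moreover have "(\<phi> ^^ n) t \<le> (\<phi> ^^ Suc n) t" for n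
    using t[of n] t[of "Suc n"] by (meson atLeastAtMost_iff order_trans)
  ultimately have "strict_mono (\<lambda>n. (\<phi> ^^ n) t)" by (intro strict_mono_orbit)
  with t t_lim show thesis using that unfolding a_def by blast
qed

theorem theorem2p1:
  fixes \<phi> :: "real \<Rightarrow> real"
  assumes "continuous_on {0..} \<phi>"
    and "\<phi> \<in> {0..} \<rightarrow> {0..}"
  shows
    "((\<exists>t>0. filterlim (\<lambda>n. (\<phi> ^^ n) t) at_top sequentially) \<longleftrightarrow>
        (\<exists>t'>0. \<not> bounded (range (\<lambda>n. (\<phi> ^^ n) t')))) \<and>
     ((\<exists>t>0. filterlim (\<lambda>n. (\<phi> ^^ n) t) at_top sequentially) \<longleftrightarrow>
        (\<exists>T>0. \<forall>t\<ge>T. max_fun \<phi> t > t)) \<and>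
     ((\<exists>t>0. filterlim (\<lambda>n. (\<phi> ^^ n) t) at_top sequentially) \<longleftrightarrow>
        (\<exists>t T. t \<ge> T \<and> T > 0 \<and>
           strict_mono (\<lambda>n. (\<phi> ^^ n) t) \<and>
           filterlim (\<lambda>n. (\<phi> ^^ n) t) at_top sequentially \<and>
           strict_mono (\<lambda>n. (max_fun \<phi> ^^ n) T) \<and>
           filterlim (\<lambda>n. (max_fun \<phi> ^^ n) T) at_top sequentially \<and>
           (\<forall>n. (\<phi> ^^ n) t \<in> {(max_fun \<phi> ^^ n) T .. (max_fun \<phi> ^^ (n + 1)) T}))) \<and>
     ((\<exists>t>0. filterlim (\<lambda>n. (\<phi> ^^ n) t) at_top sequentially) \<longleftrightarrow>
        (\<exists>\<tau> :: nat \<Rightarrow> real. (\<forall>n. \<tau> n > 0) \<and>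
           filterlim \<tau> at_top sequentially \<and>
           (\<forall>n. \<phi> (\<tau> n) \<ge> \<tau> (n + 1))))"
proof -
  let ?a = "\<exists>t>0. filterlim (\<lambda>n. (\<phi> ^^ n) t) at_top sequentially"
  let ?b = "\<exists>t'>0. \<not> bounded (range (\<lambda>n. (\<phi> ^^ n) t'))"
  let ?c = "\<exists>T>0. \<forall>t\<ge>T. max_fun \<phi> t > t"
  let ?d = "\<exists>t T. t \<ge> T \<and> T > 0 \<and>
           strict_mono (\<lambda>n. (\<phi> ^^ n) t) \<and>
           filterlim (\<lambda>n. (\<phi> ^^ n) t) at_top sequentially \<and>
           strict_mono (\<lambda>n. (max_fun \<phi> ^^ n) T) \<and>
           filterlim (\<lambda>n. (max_fun \<phi> ^^ n) T) at_top sequentially \<and>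
           (\<forall>n. (\<phi> ^^ n) t \<in> {(max_fun \<phi> ^^ n) T .. (max_fun \<phi> ^^ (n + 1)) T})"
  let ?e = "\<exists>\<tau> :: nat \<Rightarrow> real. (\<forall>n. \<tau> n > 0) \<and>
           filterlim \<tau> at_top sequentially \<and>
           (\<forall>n. \<phi> (\<tau> n) \<ge> \<tau> (n + 1))"
  have ab: ?b if ?a
    using that by (meson filterlim_at_top_not_bdd_above bounded_imp_bdd_above)
  have bc: ?c if h: ?b
  proof -
    obtain t where t: "t > 0" "\<not> bounded (range (\<lambda>n. (\<phi> ^^ n) t))" using h by blast
    have nonneg: "0 \<le> (\<phi> ^^ n) t" for n
      by (induction n) (use assms(2) t in auto)
    then have "\<not> bdd_above (range (\<lambda>n. (\<phi> ^^ n) t))"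
      using t by (auto simp: bdd_above_def bounded_iff)
    then show ?thesis
      using nonneg by (intro max_fun_gt_of_unbounded[OF assms(1)]) auto
  qed
  have cd: ?d if h: ?c
  proof -
    obtain T where T: "T > 0" "\<And>t. t \<ge> T \<Longrightarrow> max_fun \<phi> t > t" using h by blast
    obtain t where t: "\<And>n. (\<phi> ^^ n) t \<in> {(max_fun \<phi> ^^ n) T .. (max_fun \<phi> ^^ Suc n) T}"
      "strict_mono (\<lambda>n. (\<phi> ^^ n) t)" "filterlim (\<lambda>n. (\<phi> ^^ n) t) at_top sequentially"
      using escaping_orbit[OF assms T] by blast
    then have "t \<ge> T" using t(1)[of 0] by simp
    then show ?thesis
      using t T(1) funpow_max_fun_tendsto[OF assms(1) T] unfolding Suc_eq_plus1 by blast
  qed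
  have da: ?a if ?d
    using that less_le_trans by blast
  \<comment> \<open>The orbit is taken from \<open>?d\<close> because strict growth from
    \<open>t \<ge> T > 0\<close> keeps it positive; an orbit as in \<open>?a\<close> might pass
    through 0.\<close>
  have de: ?e if h: ?d
  proof -
    obtain t T where t: "t \<ge> T" "T > 0" "strict_mono (\<lambda>n. (\<phi> ^^ n) t)"
      "filterlim (\<lambda>n. (\<phi> ^^ n) t) at_top sequentially" using h by blast
    have "(\<phi> ^^ n) t > 0" for n
      using strict_mono_mono[OF t(3), THEN monoD, of 0 n] t(1,2) by simp
    then show ?thesis using t(4) by (intro exI[of _ "\<lambda>n. (\<phi> ^^ n) t"]) auto
  qed
  have ec: ?c if h: ?e
  proof -
    obtain \<tau> :: "nat \<Rightarrow> real" where "\<And>n. \<tau> n > 0" "filterlim \<tau> at_top sequentially"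
      "\<And>n. \<phi> (\<tau> n) \<ge> \<tau> (n + 1)" using h by blast
    then show ?thesis
      by (intro max_fun_gt_of_unbounded[OF assms(1), of \<tau>] filterlim_at_top_not_bdd_above)
        (auto intro: less_imp_le)
  qed
  \<comment> \<open>The implications form the cycle \<open>?a\<close>, \<open>?b\<close>,
    \<open>?c\<close>, \<open>?d\<close>, \<open>?a\<close>, with \<open>?e\<close> attached by the
    detour from \<open>?d\<close> through \<open>?e\<close> to \<open>?c\<close>.\<close>
  from ab bc cd da de ec show ?thesis by argo
qed

end
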